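(* Let $A_d\in\mathbb{R}^{n\times n}$, $B_d\in\mathbb{R}^{n\times m}$, let $\pi:\mathbb{R}^n\to\mathbb{R}^m$ be an $\ell$-layer ReLU feedforward neural network, and let $\mathbf{f}_{cl}(x)=A_dx+B_d\pi(x)$. Let $\mathcal{Z}=CZ\{\mathbf{c},\mathbf{G},\mathbf{A},\mathbf{b}\}\subset\mathbb{R}^n$ be any constrained zonotope, with $\mathbf{G}\in\mathbb{R}^{n\times n_G}$ and $\mathbf{A}\in\mathbb{R}^{n_A\times n_G}$, and let $\hat\pi(\mathcal{Z})=CZ\{\hat{\mathbf{c}},\hat{\mathbf{G}},\hat{\mathbf{A}},\hat{\mathbf{b}}\}\supseteq\pi(\mathcal{Z})$ be the output set computed by the over-approximated output analysis algorithm (described in the context) from the input $\mathcal{Z}$. Let $n_{\hat G}$ be the number of columns of $\hat{\mathbf{G}}$. Then $$\hat{\mathbf{f}}_{cl}(\mathcal{Z}):=CZ\{\hat{\mathbf{c}}_{cl},\hat{\mathbf{G}}_{cl},\hat{\mathbf{A}}_{cl},\hat{\mathbf{b}}_{cl}\}\supseteq\mathbf{f}_{cl}(\mathcal{Z}),$$ where $$\hat{\mathbf{G}}_{cl}=A_d\begin{bmatrix}\mathbf{G}&\mathbf{0}_{n\times(n_{\hat G}-n_G)}\end{bmatrix}+B_d\hat{\mathbf{G}},\quad \hat{\mathbf{c}}_{cl}=A_d\mathbf{c}+B_d\hat{\mathbf{c}},\quad \hat{\mathbf{A}}_{cl}=\hat{\mathbf{A}},\quad \hat{\mathbf{b}}_{cl}=\hat{\mathbf{b}}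 .$$
   Context: Constrained zonotopes. For $\mathbf{c}\in\mathbb{R}^n$, $\mathbf{G}\in\mathbb{R}^{n\times n_G}$, $\mathbf{A}\in\mathbb{R}^{n_A\times n_G}$, $\mathbf{b}\in\mathbb{R}^{n_A}$, write $CZ\{\mathbf{c},\mathbf{G},\mathbf{A},\mathbf{b}\}=\{\mathbf{G}\xi+\mathbf{c} : \|\xi\|_\infty\le 1,\ \mathbf{A}\xi=\mathbf{b}\}$. For a set $\mathcal{Z}$, $\mathbf{f}_{cl}(\mathcal{Z})=\{\mathbf{f}_{cl}(x):x\in\mathcal{Z}\}$ and $\pi(\mathcal{Z})=\{\pi(x):x\in\mathcal{Z}\}$. Network. Given weight matrices $\mathbf{W}^{(0)},\dots,\mathbf{W}^{(\ell-1)}$ and bias vectors $\mathbf{v}^{(0)},\dots,\mathbf{v}^{(\ell-1)}$ of compatible sizes, $\pi$ is defined by $x^{(0)}=x$, $x^{(k)}=\max\{0,\mathbf{W}^{(k-1)}x^{(k-1)}+\mathbf{v}^{(k-1)}\}$ (componentwise) for $k=1,\dots,\ell-1$, and $\pi(x)=\mathbf{W}^{(\ell-1)}x^{(\ell-1)}+\mathbf{v}^{(\ell-1)}$. Over-approximated output analysis algorithm. It maintains a single constrained zonotope with its data $(\mathbf{c},\mathbf{G},\mathbf{A},\mathbf{b})$, initially $\mathcal{Z}$. For each layer $k=1,\dots,\ell-1$, with $\mathbf{W}=\mathbf{W}^{(k-1)}$, $\mathbf{v}=\mathbf{v}^{(k-1)}$: (1) Replace the current $CZ\{\mathbf{c},\mathbf{G},\mathbf{A},\mathbf{b}\}$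 by $\mathcal{I}=CZ\{\mathbf{W}\mathbf{c}+\mathbf{v},\mathbf{W}\mathbf{G},\mathbf{A},\mathbf{b}\}\subset\mathbb{R}^{n_I}$, and let $l_i,u_i$ be the minimum and maximum of the $i$-th coordinate over this $\mathcal{I}$ (if $\mathcal{I}$ is empty, step (2) is skipped). (2) Successively for each coordinate $i$ with $l_i<0$, update the current $\mathcal{I}=CZ\{\mathbf{c},\mathbf{G},\mathbf{A},\mathbf{b}\}$ as follows, where $\mathbf{E}_i$ is the $n_I\times n_I$ identity matrix with its $i$-th column replaced by $0$, $\mathbf{e}_i$ is the $i$-th canonical vector, and $\mathbf{G}[i,:]$, $\mathbf{c}[i]$ denote the $i$-th row of $\mathbf{G}$ and $i$-th entry of $\mathbf{c}$. If $u_i\le0$, replace $\mathcal{I}$ by $CZ\{\mathbf{E}_i\mathbf{c},\mathbf{E}_i\mathbf{G},\mathbf{A},\mathbf{b}\}$. If $u_i>0$, replace $\mathcal{I}$ by $CZ\{\mathbf{c}',\mathbf{G}',\mathbf{A}',\mathbf{b}'\}$ with $$\mathbf{c}'=\mathbf{E}_i\mathbf{c},\quad \mathbf{G}'=\begin{bmatrix}\mathbf{E}_i\mathbf{G}&u_i\mathbf{e}_i&\mathbf{0}&\mathbf{0}&\mathbf{0}\end{bmatrix},\quad \mathbf{A}'=\begin{bmatrix}\mathbf{A}&\mathbf{0}&\mathbf{0}&\mathbf{0}&\mathbf{0}\\ \mathbf{0}&1&1&0&0\\ -\mathbf{G}[i,:]&u_i&0&u_i-l_i&0\\ -\mathbf{G}[i,:]&u_i-l_i&0&0&u_i-l_i\end{bmatrix},\quad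 \mathbf{b}'=\begin{bmatrix}\mathbf{b}\\1\\ \mathbf{c}[i]+u_i-l_i\\ \mathbf{c}[i]-u_i\end{bmatrix}.$$ In the last layer, the current $CZ\{\mathbf{c},\mathbf{G},\mathbf{A},\mathbf{b}\}$ is replaced by $CZ\{\mathbf{W}^{(\ell-1)}\mathbf{c}+\mathbf{v}^{(\ell-1)},\mathbf{W}^{(\ell-1)}\mathbf{G},\mathbf{A},\mathbf{b}\}$, which is the output $\hat\pi(\mathcal{Z})$. *)

theory Defs
  imports Complex_Main "Jordan_Normal_Form.Matrix"
begin

section \<open>Constrained zonotopes\<close>

text \<open>
  Vectors and matrices are those of \<open>Jordan_Normal_Form.Matrix\<close>, whose dimensions are values, because
  the number of generators and of constraints grows while the algorithm runs. Indices start at 0.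
\<close>

text \<open>The element 0 only matters for the empty vector, where it gives norm 0.\<close>
definition linf_norm :: "real vec \<Rightarrow> real" where
  "linf_norm \<xi> = Max (insert 0 {\<bar>\<xi> $ i\<bar> | i. i < dim_vec \<xi>})"

text \<open>The data \<open>(c, G, A, b)\<close> of a constrained zonotope.\<close>
type_synonym cz_data = "real vec \<times> real mat \<times> real mat \<times> real vec"

fun CZ :: "cz_data \<Rightarrow> real vec set" where
  "CZ (c, G, A, b) =
     {G *\<^sub>v \<xi> + c | \<xi>. \<xi> \<in> carrier_vec (dim_col G) \<and> linf_norm \<xi> \<le> 1 \<and> A *\<^sub>v \<xi> = b}"

fun affine_image :: "real mat \<Rightarrow> real vec \<Rightarrow> cz_data \<Rightarrow> cz_data" where
  "affine_image W v (c, G, A, b) = (W *\<^sub>v c + v, W * G, A, b)"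

definition append_cols :: "real mat \<Rightarrow> real mat \<Rightarrow> real mat"  (infixr \<open>@\<^sub>c\<close> 65) where
  "A @\<^sub>c B = four_block_mat A B (0\<^sub>m 0 (dim_col A)) (0\<^sub>m 0 (dim_col B))"


section \<open>ReLU networks\<close>

definition relu :: "real vec \<Rightarrow> real vec" where
  "relu x = map_vec (\<lambda>t. max 0 t) x"

text \<open>\<open>hidden W v x k\<close> is the vector $x^{(k)}$.\<close>
primrec hidden :: "(nat \<Rightarrow> real mat) \<Rightarrow> (nat \<Rightarrow> real vec) \<Rightarrow> real vec \<Rightarrow> nat \<Rightarrow> real vec" where
  "hidden W v x 0 = x"
| "hidden W v x (Suc k) = relu (W k *\<^sub>v hidden W v x k + v k)"

definition network :: "(nat \<Rightarrow> real mat) \<Rightarrow> (nat \<Rightarrow> real vec) \<Rightarrow> nat \<Rightarrow> real vec \<Rightarrow> real vec" where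
  "network W v L x = W (L - 1) *\<^sub>v hidden W v x (L - 1) + v (L - 1)"

definition closed_loop ::
    "real mat \<Rightarrow> real mat \<Rightarrow> (real vec \<Rightarrow> real vec) \<Rightarrow> real vec \<Rightarrow> real vec" where
  "closed_loop A\<^sub>d B\<^sub>d \<pi> x = A\<^sub>d *\<^sub>v x + B\<^sub>d *\<^sub>v \<pi> x"


section \<open>Over-approximated output analysis\<close>

text \<open>
  A nonempty constrained zonotope is compact, so these extrema are attained; they are only used for
  nonempty sets.
\<close>
definition coord_min :: "real vec set \<Rightarrow> nat \<Rightarrow> real" where
  "coord_min S i = (LEAST t. t \<in> (\<lambda>y. y $ i) ` S)"

definition coord_max :: "real vec set \<Rightarrow> nat \<Rightarrow> real" where
  "coord_max S i = (GREATEST t. t \<in> (\<lambda>y. y $ i) ` S)"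

definition zero_coord_mat :: "nat \<Rightarrow> nat \<Rightarrow> real mat" where
  "zero_coord_mat n i = mat n n (\<lambda>(r, s). if s = i then 0 else 1\<^sub>m n $$ (r, s))"

text \<open>
  The update of coordinate \<open>i\<close> for a lower bound \<open>l < 0\<close> and an upper bound \<open>u\<close>. In the case
  \<open>u > 0\<close> the four new generators and the three new constraints describe the triangle relaxation
  of the ReLU function on \<open>[l, u]\<close>.
\<close>
fun relax_coord :: "real \<Rightarrow> real \<Rightarrow> nat \<Rightarrow> cz_data \<Rightarrow> cz_data" where
  "relax_coord l u i (c, G, A, b) =
     (let n = dim_vec c; E = zero_coord_mat n i; g = - row G i in
      if u \<le> 0 then (E *\<^sub>v c, E * G, A, b)
      else
        (E *\<^sub>v c,
         E * G @\<^sub>c mat_of_cols n [u \<cdot>\<^sub>v unit_vec n i, 0\<^sub>v n, 0\<^sub>v n, 0\<^sub>v n],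
         four_block_mat
           A (0\<^sub>m (dim_row A) 4)
           (mat_of_rows (dim_col G) [0\<^sub>v (dim_col G), g, g])
           (mat_of_rows_list 4
             [[1,     1, 0,     0],
              [u,     0, u - l, 0],
              [u - l, 0, 0,     u - l]]),
         b @\<^sub>v vec_of_list [1, c $ i + u - l, c $ i - u]))"

text \<open>
  All bounds are taken over the set at the beginning of the step, not over the intermediate sets.
\<close>
definition relax_relu :: "cz_data \<Rightarrow> cz_data" where
  "relax_relu Z =
     (let l = coord_min (CZ Z); u = coord_max (CZ Z) in
      if CZ Z = {} then Z
      else fold (\<lambda>i. relax_coord (l i) (u i) i) (filter (\<lambda>i. l i < 0) [0..<dim_vec (fst Z)]) Z)"

primrec hidden_approx ::
    "(nat \<Rightarrow> real mat) \<Rightarrow> (nat \<Rightarrow> real vec) \<Rightarrow> cz_data \<Rightarrow> nat \<Rightarrow> cz_data" where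
  "hidden_approx W v Z 0 = Z"
| "hidden_approx W v Z (Suc k) = relax_relu (affine_image (W k) (v k) (hidden_approx W v Z k))"

definition output_approx ::
    "(nat \<Rightarrow> real mat) \<Rightarrow> (nat \<Rightarrow> real vec) \<Rightarrow> nat \<Rightarrow> cz_data \<Rightarrow> cz_data" where
  "output_approx W v L Z = affine_image (W (L - 1)) (v (L - 1)) (hidden_approx W v Z (L - 1))"

end

theory Submission
  imports Defs "HOL-Analysis.Function_Topology"
begin

text \<open>
  Every step of the analysis acts on coefficient vectors only by extension. If a coefficient vector
  \<open>\<xi>\<close> of the input zonotope produces the point \<open>x\<close>, then after \<open>k\<close> layers some admissible
  coefficient vector \<open>\<xi> @\<^sub>v \<eta>\<close>, with \<open>\<xi>\<close> as its initial segment, produces the hidden vector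
  \<open>hidden W v x k\<close>, and at the end some \<open>\<xi> @\<^sub>v \<eta>\<close> produces the network output. The generator matrix
  of the input, padded with zero columns, sends this longer vector to the same point as \<open>\<xi>\<close>.
  Hence one coefficient vector represents both \<open>x\<close> and the network output at \<open>x\<close>, and the closed
  loop, being linear in this pair, can be evaluated on the generators. That is what makes the result
  stronger than the inclusion of the output set alone: a Minkowski sum of the two zonotopes would
  lose the dependence between state and input.

  The extension is clear for affine layers, where \<open>\<eta>\<close> is empty. For the relaxation
  of a coordinate whose range \<open>[l, u]\<close> contains 0 in its interior, \<open>relax_coord_generates\<close> supplies
  four new coefficients. The first is the value of the ReLU function divided by \<open>u\<close>, and the other
  three are the slacks that turn the inequalities of the triangle into equations; these
  coefficients lie in \<open>[-1, 1]\<close> by \<open>triangle_slacks\<close>. This uses that \<open>l\<close> and \<open>u\<close> really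
  bound the coordinate. They are defined as a least and a greatest element, which exist because a
  coordinate of a constrained zonotope takes values in a compact set (\<open>compact_coord_CZ\<close>).
\<close>

section \<open>Norm bounds and block products\<close>

lemma linf_norm_le_1_iff: "linf_norm \<xi> \<le> 1 \<longleftrightarrow> (\<forall>i<dim_vec \<xi>. \<bar>\<xi> $ i\<bar> \<le> 1)"
proof -
  have "finite {\<bar>\<xi> $ i\<bar> | i. i < dim_vec \<xi>}" by simp
  then show ?thesis unfolding linf_norm_def by (subst Max_le_iff) auto
qed

lemma linf_norm_append_le_1:
  assumes "linf_norm \<xi> \<le> 1" and "linf_norm \<eta> \<le> 1"
  shows "linf_norm (\<xi> @\<^sub>v \<eta>) \<le> 1"
  unfolding linf_norm_le_1_iff
proof (intro allI impI)
  fix i assume "i < dim_vec (\<xi> @\<^sub>v \<eta>)"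
  then show "\<bar>(\<xi> @\<^sub>v \<eta>) $ i\<bar> \<le> 1"
    using assms by (cases "i < dim_vec \<xi>") (auto simp: linf_norm_le_1_iff)
qed

lemma append_cols_carrier:
  assumes "A \<in> carrier_mat n p" "B \<in> carrier_mat n q"
  shows "A @\<^sub>c B \<in> carrier_mat n (p + q)"
  using assms four_block_carrier_mat[OF assms(1), of "0\<^sub>m 0 q" 0 q]
  unfolding append_cols_def by auto

lemma append_cols_mult_append_vec:
  assumes A: "A \<in> carrier_mat n p" and B: "B \<in> carrier_mat n q"
    and x: "x \<in> carrier_vec p" and y: "y \<in> carrier_vec q"
  shows "(A @\<^sub>c B) *\<^sub>v (x @\<^sub>v y) = A *\<^sub>v x + B *\<^sub>v y"
proof -
  have "(A @\<^sub>c B) *\<^sub>v (x @\<^sub>v y)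
    = (A *\<^sub>v x + B *\<^sub>v y) @\<^sub>v (0\<^sub>m 0 p *\<^sub>v x + 0\<^sub>m 0 q *\<^sub>v y)"
    using A B x y unfolding append_cols_def
    by (subst four_block_mat_mult_vec[where ?nr1.0 = n and ?nr2.0 = 0]) auto
  then show ?thesis using A B by (intro eq_vecI) auto
qed

section \<open>Coefficient vectors of a constrained zonotope\<close>

text \<open>The constraint matrix has one row per entry of \<open>b\<close>, a number that grows during the analysis.\<close>
fun well_formed :: "nat \<Rightarrow> cz_data \<Rightarrow> bool" where
  "well_formed n (c, G, A, b) \<longleftrightarrow>
     c \<in> carrier_vec n \<and> dim_row G = n \<and> A \<in> carrier_mat (dim_vec b) (dim_col G)"

text \<open>
  Membership in \<open>CZ\<close> with the coefficient vector made explicit, because the argument has to follow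
  one coefficient vector through the whole analysis.
\<close>
fun generates :: "cz_data \<Rightarrow> real vec \<Rightarrow> real vec \<Rightarrow> bool" where
  "generates (c, G, A, b) \<xi> y \<longleftrightarrow>
     \<xi> \<in> carrier_vec (dim_col G) \<and> linf_norm \<xi> \<le> 1 \<and> A *\<^sub>v \<xi> = b \<and> y = G *\<^sub>v \<xi> + c"

lemma CZ_conv_generates: "CZ Z = {y. \<exists>\<xi>. generates Z \<xi> y}"
  by (cases Z) auto

lemma generates_carrier:
  assumes "well_formed n Z" "generates Z \<xi> y"
  shows "y \<in> carrier_vec n"
  using assms by (cases Z) (auto intro!: carrier_vecI)

section \<open>Attainment of the coordinate bounds\<close>

text \<open>
  Coefficient vectors are read as functions on all natural numbers, where the cube \<open>[-1, 1]\<^sup>\<nat>\<close> is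
  compact by Tychonoff's theorem. The finitely many linear constraints cut out a closed subset,
  and the coordinate is a continuous function of the coefficients.
\<close>
lemma compact_coord_CZ:
  assumes wf: "well_formed n Z" and i: "i < n"
  shows "compact ((\<lambda>y. y $ i) ` CZ Z)"
proof -
  obtain c G A b where Z: "Z = (c, G, A, b)" by (cases Z)
  define N where "N = dim_col G"
  have c: "c \<in> carrier_vec n" and G: "G \<in> carrier_mat n N" and A: "A \<in> carrier_mat (dim_vec b) N"
    using wf by (auto simp: Z N_def)
  define K where "K = PiE UNIV (\<lambda>_::nat. {-1..1::real}) \<inter>
    (\<Inter>r\<in>{..<dim_vec b}. {f. (\<Sum>j<N. A $$ (r, j) * f j) = b $ r})"
  define h where "h f = (\<Sum>j<N. G $$ (i, j) * f j) + c $ i" for f :: "nat \<Rightarrow> real"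
  have "compactin (product_topology (\<lambda>_. euclidean) UNIV) (PiE UNIV (\<lambda>_::nat. {-1..1::real}))"
    by (subst compactin_PiE) auto
  then have "compact (PiE UNIV (\<lambda>_::nat. {-1..1::real}))"
    by (simp add: euclidean_product_topology)
  moreover have "closed (\<Inter>r\<in>{..<dim_vec b}. {f. (\<Sum>j<N. A $$ (r, j) * f j) = b $ r})"
    by (intro closed_INT ballI closed_Collect_eq continuous_intros) simp_all
  ultimately have "compact K"
    unfolding K_def by (rule compact_Int_closed)
  moreover have "continuous_on K h"
    unfolding h_def
    by (intro continuous_intros continuous_on_subset[OF continuous_on_product_coordinates]) simp
  ultimately have comp: "compact (h ` K)" by (rule compact_continuous_image[rotated])
  have mem: "(\<lambda>y. y $ i) ` CZ Z = h ` K"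
  proof (intro equalityI subsetI)
    fix t assume "t \<in> (\<lambda>y. y $ i) ` CZ Z"
    then obtain \<xi> where \<xi>: "\<xi> \<in> carrier_vec N" "linf_norm \<xi> \<le> 1" "A *\<^sub>v \<xi> = b"
      and t: "t = (G *\<^sub>v \<xi> + c) $ i"
      by (auto simp: Z N_def)
    \<comment> \<open>Only the first \<open>N\<close> values of the function matter; the rest is padded by 0.\<close>
    define f where "f j = (if j < N then \<xi> $ j else 0)" for j
    have "(A *\<^sub>v \<xi>) $ r = (\<Sum>j<N. A $$ (r, j) * f j)" if "r < dim_vec b" for r
      using that A \<xi>(1) by (auto simp: scalar_prod_def f_def atLeast0LessThan intro!: sum.cong)
    moreover have "\<bar>f j\<bar> \<le> 1" for j
      using \<xi>(1,2) by (auto simp: linf_norm_le_1_iff f_def)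
    ultimately have "f \<in> K"
      using \<xi>(3) by (auto simp: K_def abs_le_iff PiE_iff minus_le_iff)
    moreover have "t = h f"
      unfolding t h_def using i c G \<xi>(1)
      by (auto simp: scalar_prod_def f_def atLeast0LessThan intro!: sum.cong)
    ultimately show "t \<in> h ` K" by blast
  next
    fix t assume "t \<in> h ` K"
    then obtain f where f: "f \<in> K" and t: "t = h f" by blast
    define \<xi> where "\<xi> = vec N f"
    have "(A *\<^sub>v \<xi>) $ r = b $ r" if "r < dim_vec b" for r
    proof -
      have "(A *\<^sub>v \<xi>) $ r = (\<Sum>j<N. A $$ (r, j) * f j)"
        using that A by (auto simp: scalar_prod_def \<xi>_def atLeast0LessThan intro!: sum.cong)
      also have "\<dots> = b $ r" using f that by (auto simp: K_def)
      finally show ?thesis .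
    qed
    then have "A *\<^sub>v \<xi> = b" using A by (intro eq_vecI) auto
    moreover have "linf_norm \<xi> \<le> 1"
      using f by (auto simp: linf_norm_le_1_iff \<xi>_def K_def PiE_iff abs_le_iff minus_le_iff)
    moreover have "t = (G *\<^sub>v \<xi> + c) $ i"
      unfolding t h_def using i c G
      by (auto simp: scalar_prod_def \<xi>_def atLeast0LessThan intro!: sum.cong)
    moreover have "\<xi> \<in> carrier_vec (dim_col G)" by (simp add: \<xi>_def N_def)
    ultimately show "t \<in> (\<lambda>y. y $ i) ` CZ Z" by (auto simp: Z)
  qed
  show ?thesis using comp by (simp add: mem)
qed

lemma coord_bounds:
  assumes wf: "well_formed n Z" and i: "i < n" and y: "y \<in> CZ Z"
  shows "coord_min (CZ Z) i \<le> y $ i" and "y $ i \<le> coord_max (CZ Z) i"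
proof -
  let ?S = "(\<lambda>y. y $ i) ` CZ Z"
  have S: "compact ?S" "?S \<noteq> {}" using compact_coord_CZ[OF wf i] y by auto
  obtain s where s: "s \<in> ?S" "\<forall>t\<in>?S. s \<le> t" using compact_attains_inf[OF S] by blast
  obtain s' where s': "s' \<in> ?S" "\<forall>t\<in>?S. t \<le> s'" using compact_attains_sup[OF S] by blast
  have "coord_min (CZ Z) i = s"
    unfolding coord_min_def using s by (intro Least_equality) auto
  then show "coord_min (CZ Z) i \<le> y $ i" using s(2) y by auto
  have "coord_max (CZ Z) i = s'"
    unfolding coord_max_def using s' by (intro Greatest_equality) auto
  then show "y $ i \<le> coord_max (CZ Z) i" using s'(2) y by auto
qed

section \<open>The triangle relaxation of one coordinate\<close>

definition relu_at :: "nat \<Rightarrow> real vec \<Rightarrow> real vec" where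
  "relu_at i y = vec (dim_vec y) (\<lambda>j. if j = i then max 0 (y $ j) else y $ j)"

lemma zero_coord_mat_carrier [simp]: "zero_coord_mat n i \<in> carrier_mat n n"
  by (simp add: zero_coord_mat_def)

lemma zero_coord_mat_mult_vec:
  assumes "x \<in> carrier_vec n"
  shows "zero_coord_mat n i *\<^sub>v x = vec n (\<lambda>j. if j = i then 0 else x $ j)"
proof (rule eq_vecI)
  fix j assume "j < dim_vec (vec n (\<lambda>j. if j = i then 0 else x $ j))"
  then have j: "j < n" by simp
  have "row (zero_coord_mat n i) j = (if j = i then 0\<^sub>v n else unit_vec n j)"
    using j by (intro eq_vecI) (auto simp: zero_coord_mat_def unit_vec_def)
  then show "(zero_coord_mat n i *\<^sub>v x) $ j = vec n (\<lambda>j. if j = i then 0 else x $ j) $ j"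
    using j assms by (auto simp: zero_coord_mat_def)
qed (simp add: zero_coord_mat_def)

text \<open>
  The first coefficient is the height \<open>r = max 0 t\<close> in units of \<open>u\<close>. The other three are the
  slacks of the inequalities \<open>r \<ge> 0\<close>, \<open>r \<ge> t\<close> and \<open>r \<le> u * (t - l) / (u - l)\<close> that describe
  the triangle, shifted and scaled so that they lie in \<open>[-1, 1]\<close>.
\<close>
lemma triangle_slacks:
  fixes l u t :: real
  assumes "l < 0" "0 < u" "l \<le> t" "t \<le> u"
  obtains e\<^sub>1 e\<^sub>2 e\<^sub>3 e\<^sub>4 where
    "\<bar>e\<^sub>1\<bar> \<le> 1" "\<bar>e\<^sub>2\<bar> \<le> 1" "\<bar>e\<^sub>3\<bar> \<le> 1" "\<bar>e\<^sub>4\<bar> \<le> 1"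
    "u * e\<^sub>1 = max 0 t" "e\<^sub>1 + e\<^sub>2 = 1" "u * e\<^sub>1 + (u - l) * e\<^sub>3 = t + u - l"
    "(u - l) * e\<^sub>1 + (u - l) * e\<^sub>4 = t - u"
proof -
  define r where "r = max 0 t"
  define e\<^sub>3 where "e\<^sub>3 = 1 + (t - r) / (u - l)"
  define e\<^sub>4 where "e\<^sub>4 = (t - u) / (u - l) - r / u"
  have r: "0 \<le> r / u" "r / u \<le> 1" using assms by (auto simp: r_def)
  have "- 1 \<le> (t - r) / (u - l)" "(t - r) / (u - l) \<le> 0"
    using assms by (auto simp: field_simps r_def divide_le_0_iff max_def)
  then have 3: "\<bar>e\<^sub>3\<bar> \<le> 1" by (auto simp: e\<^sub>3_def)
  have le: "(t - u) / (u - l) \<le> 0" using assms by (simp add: divide_le_0_iff)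
  have "- 1 \<le> e\<^sub>4"
  proof (cases "0 \<le> t")
    case True
    \<comment> \<open>Over the common denominator \<open>u - l\<close> the numerator is \<open>l * t / u - u\<close>, and \<open>t \<le> u\<close> with
      \<open>l < 0\<close> makes it at least \<open>l - u\<close>.\<close>
    have "l * 1 \<le> l * (t / u)" using assms by (intro mult_left_mono_neg) auto
    then have "- (u - l) \<le> l * (t / u) - u" by simp
    moreover have "(t - u) / (u - l) - t / u = (l * (t / u) - u) / (u - l)"
      using assms by (simp add: field_simps)
    ultimately show ?thesis
      using assms True by (simp add: le_divide_eq e\<^sub>4_def r_def)
  next
    case False
    have "- 1 \<le> (t - u) / (u - l)" using assms by (simp add: le_divide_eq)
    then show ?thesis using False by (simp add: e\<^sub>4_def r_def)
  qed
  then have 4: "\<bar>e\<^sub>4\<bar> \<le> 1" using le r(1) unfolding e\<^sub>4_def abs_le_iff by simp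
  show ?thesis
  proof (rule that[of "r / u" "1 - r / u" e\<^sub>3 e\<^sub>4])
    show "\<bar>r / u\<bar> \<le> 1" "\<bar>1 - r / u\<bar> \<le> 1" using r by auto
    have r_u: "u * (r / u) = r" using assms by simp
    then show "u * (r / u) = max 0 t" by (simp add: r_def)
    have "(u - l) * e\<^sub>3 = (u - l) + (t - r)"
      using assms by (simp add: e\<^sub>3_def distrib_left)
    then show "u * (r / u) + (u - l) * e\<^sub>3 = t + u - l" using r_u by simp
    have "(u - l) * e\<^sub>4 = (t - u) - (u - l) * (r / u)"
      using assms unfolding e\<^sub>4_def right_diff_distrib[of "u - l" "(t - u) / (u - l)"] by simp
    then show "(u - l) * (r / u) + (u - l) * e\<^sub>4 = t - u" by simp
  qed (use 3 4 in auto)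
qed

text \<open>
  The ReLU graph lies in its triangle relaxation: for \<open>u > 0\<close> the slacks of \<open>triangle_slacks\<close> at
  \<open>t = y $ i\<close> extend \<open>\<xi>\<close>. For \<open>u \<le> 0\<close> the ReLU function vanishes on the whole range, which is
  what erasing the coordinate computes, and nothing has to be appended.
\<close>
lemma relax_coord_generates:
  assumes wf: "well_formed n Z" and gen: "generates Z \<xi> y" and i: "i < n"
    and l: "l < 0" "l \<le> y $ i" and u: "y $ i \<le> u"
  shows "well_formed n (relax_coord l u i Z) \<and>
    (\<exists>\<eta>. generates (relax_coord l u i Z) (\<xi> @\<^sub>v \<eta>) (relu_at i y))"
proof -
  obtain c G A b where Z: "Z = (c, G, A, b)" by (cases Z)
  define N where "N = dim_col G"
  define E where "E = zero_coord_mat n i"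
  have c: "c \<in> carrier_vec n" and G: "G \<in> carrier_mat n N" and A: "A \<in> carrier_mat (dim_vec b) N"
    using wf by (auto simp: Z N_def)
  have \<xi>: "\<xi> \<in> carrier_vec N" "linf_norm \<xi> \<le> 1" "A *\<^sub>v \<xi> = b" and y: "y = G *\<^sub>v \<xi> + c"
    using gen by (auto simp: Z N_def)
  have yc: "y \<in> carrier_vec n" using generates_carrier[OF wf gen] .
  have E: "E \<in> carrier_mat n n" by (simp add: E_def)
  have Ey: "(E * G) *\<^sub>v \<xi> + E *\<^sub>v c = vec n (\<lambda>j. if j = i then 0 else y $ j)"
  proof -
    have "(E * G) *\<^sub>v \<xi> + E *\<^sub>v c = E *\<^sub>v y"
      unfolding y using E G \<xi>(1) c by (simp add: mult_add_distrib_mat_vec[of _ n n])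
    then show ?thesis using zero_coord_mat_mult_vec[OF yc] by (simp add: E_def)
  qed
  have dims: "dim_vec c = n" "dim_col G = N" "dim_row A = dim_vec b" using c G A by auto
  show ?thesis
  proof (cases "u \<le> 0")
    case True
    have R: "relax_coord l u i Z = (E *\<^sub>v c, E * G, A, b)"
      using True by (simp add: Z E_def dims Let_def)
    have "relu_at i y = (E * G) *\<^sub>v \<xi> + E *\<^sub>v c"
      unfolding Ey relu_at_def using yc u True by (intro eq_vecI) auto
    moreover have "\<xi> @\<^sub>v vNil = \<xi>" by (intro eq_vecI) auto
    ultimately have "generates (relax_coord l u i Z) (\<xi> @\<^sub>v vNil) (relu_at i y)"
      unfolding R using \<xi> G by simp
    moreover have "well_formed n (relax_coord l u i Z)"
      unfolding R using E A G c by simp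
    ultimately show ?thesis by blast
  next
    case False
    then have u0: "0 < u" by simp
    define U where "U = mat_of_cols n [u \<cdot>\<^sub>v unit_vec n i, 0\<^sub>v n, 0\<^sub>v n, 0\<^sub>v n]"
    define C where "C = mat_of_rows N [0\<^sub>v N, - row G i, - row G i]"
    define D where "D = mat_of_rows_list 4
      [[1, 1, 0, 0], [u, 0, u - l, 0], [u - l, 0, 0, u - l :: real]]"
    define d where "d = vec_of_list [1, c $ i + u - l, c $ i - u]"
    have R: "relax_coord l u i Z = (E *\<^sub>v c, E * G @\<^sub>c U,
        four_block_mat A (0\<^sub>m (dim_vec b) 4) C D, b @\<^sub>v d)"
      using False by (simp add: Z E_def dims Let_def U_def C_def D_def d_def)
    have U: "U \<in> carrier_mat n 4" and C: "C \<in> carrier_mat 3 N" and D: "D \<in> carrier_mat 3 4"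
      and d: "d \<in> carrier_vec 3"
      by (auto simp: U_def C_def D_def d_def mat_of_rows_list_def intro!: carrier_vecI)
    obtain e\<^sub>1 e\<^sub>2 e\<^sub>3 e\<^sub>4 where
      e_le: "\<bar>e\<^sub>1\<bar> \<le> 1" "\<bar>e\<^sub>2\<bar> \<le> 1" "\<bar>e\<^sub>3\<bar> \<le> 1" "\<bar>e\<^sub>4\<bar> \<le> 1" and
      e_relu: "u * e\<^sub>1 = max 0 (y $ i)" and
      e_sys: "e\<^sub>1 + e\<^sub>2 = 1" "u * e\<^sub>1 + (u - l) * e\<^sub>3 = y $ i + u - l"
        "(u - l) * e\<^sub>1 + (u - l) * e\<^sub>4 = y $ i - u"
      using triangle_slacks[OF l(1) u0 l(2) u] .
    define \<eta> where "\<eta> = vec_of_list [e\<^sub>1, e\<^sub>2, e\<^sub>3, e\<^sub>4]"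
    have \<eta>: "\<eta> \<in> carrier_vec 4" by (simp add: \<eta>_def carrier_vecI)
    have "\<bar>\<eta> $ j\<bar> \<le> 1" if "j < 4" for j
      using that e_le by (auto simp: \<eta>_def less_Suc_eq numeral_eq_Suc)
    then have norm: "linf_norm (\<xi> @\<^sub>v \<eta>) \<le> 1"
      using \<xi>(2) \<eta> by (intro linf_norm_append_le_1) (auto simp: linf_norm_le_1_iff)
    have U\<eta>: "U *\<^sub>v \<eta> = max 0 (y $ i) \<cdot>\<^sub>v unit_vec n i"
    proof (rule eq_vecI)
      fix j assume "j < dim_vec (max 0 (y $ i) \<cdot>\<^sub>v unit_vec n i)"
      then have j: "j < n" by simp
      have "(U *\<^sub>v \<eta>) $ j = u * unit_vec n i $ j * e\<^sub>1"
        using j by (simp add: U_def \<eta>_def scalar_prod_def mat_of_cols_def numeral_eq_Suc)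
      also have "\<dots> = unit_vec n i $ j * (u * e\<^sub>1)" by simp
      finally show "(U *\<^sub>v \<eta>) $ j = (max 0 (y $ i) \<cdot>\<^sub>v unit_vec n i) $ j"
        using j by (simp add: e_relu)
    qed (use U in simp)
    \<comment> \<open>The row of \<open>G\<close> contributes \<open>c $ i - y $ i\<close>, so the new equations are those of the slacks.\<close>
    have D\<eta>: "C *\<^sub>v \<xi> + D *\<^sub>v \<eta> = d"
    proof (rule eq_vecI)
      fix j assume "j < dim_vec d"
      then have j: "j < 3" using d by simp
      have neg: "- row G i \<bullet> \<xi> = c $ i - y $ i" using i c G \<xi>(1) by (simp add: y)
      have "(C *\<^sub>v \<xi>) $ j = [0, c $ i - y $ i, c $ i - y $ i] ! j"
        using j G \<xi>(1) neg by (auto simp: C_def less_Suc_eq numeral_eq_Suc)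
      moreover have "(D *\<^sub>v \<eta>) $ j =
        [e\<^sub>1 + e\<^sub>2, u * e\<^sub>1 + (u - l) * e\<^sub>3, (u - l) * e\<^sub>1 + (u - l) * e\<^sub>4] ! j"
        using j by (auto simp: D_def \<eta>_def scalar_prod_def mat_of_rows_list_def less_Suc_eq
            numeral_eq_Suc)
      ultimately show "(C *\<^sub>v \<xi> + D *\<^sub>v \<eta>) $ j = d $ j"
        using j C D unfolding e_sys by (auto simp: d_def less_Suc_eq numeral_eq_Suc)
    qed (use C D d in simp)
    have "four_block_mat A (0\<^sub>m (dim_vec b) 4) C D *\<^sub>v (\<xi> @\<^sub>v \<eta>) = b @\<^sub>v d"
    proof -
      have "b + 0\<^sub>m (dim_vec b) 4 *\<^sub>v \<eta> = b" using \<eta> by (intro eq_vecI) auto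
      then show ?thesis
        using \<xi>(3) D\<eta> by (simp add: four_block_mat_mult_vec[OF A _ C D \<xi>(1) \<eta>])
    qed
    moreover have "(E * G @\<^sub>c U) *\<^sub>v (\<xi> @\<^sub>v \<eta>) + E *\<^sub>v c = relu_at i y"
    proof -
      have "(E * G @\<^sub>c U) *\<^sub>v (\<xi> @\<^sub>v \<eta>) + E *\<^sub>v c
        = ((E * G) *\<^sub>v \<xi> + E *\<^sub>v c) + max 0 (y $ i) \<cdot>\<^sub>v unit_vec n i"
        using E G c append_cols_mult_append_vec[OF _ U \<xi>(1) \<eta>, of "E * G"]
        by (intro eq_vecI) (auto simp: U\<eta>)
      also have "\<dots> = relu_at i y"
        unfolding Ey relu_at_def using yc i by (intro eq_vecI) auto
      finally show ?thesis .
    qed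
    moreover have EGU: "E * G @\<^sub>c U \<in> carrier_mat n (N + 4)"
      using E G U by (intro append_cols_carrier) auto
    moreover have "\<xi> @\<^sub>v \<eta> \<in> carrier_vec (N + 4)" using \<xi>(1) \<eta> by simp
    ultimately have "generates (relax_coord l u i Z) (\<xi> @\<^sub>v \<eta>) (relu_at i y)"
      unfolding R using norm by auto
    moreover have "well_formed n (relax_coord l u i Z)"
    proof -
      have "dim_vec (b @\<^sub>v d) = dim_vec b + 3" using d by simp
      then show ?thesis
        unfolding R using E c EGU four_block_carrier_mat[OF A D, of "0\<^sub>m (dim_vec b) 4" C]
        by auto
    qed
    ultimately show ?thesis by blast
  qed
qed

section \<open>Propagation through the layers\<close>

lemma append_vec_assoc: "(x @\<^sub>v y) @\<^sub>v z = x @\<^sub>v (y @\<^sub>v z)"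
  by (intro eq_vecI) auto

text \<open>
  Bounds computed once, before any update, stay valid because relaxing one coordinate leaves the
  others unchanged. Distinctness ensures that no coordinate is updated before its own turn.
\<close>
lemma fold_relax_coord_generates:
  assumes "distinct is"
    and "\<And>i. i \<in> set is \<Longrightarrow> i < n \<and> l i < 0 \<and> l i \<le> y $ i \<and> y $ i \<le> u i"
    and "well_formed n Z" and "generates Z \<xi> y"
  shows "well_formed n (fold (\<lambda>i. relax_coord (l i) (u i) i) is Z) \<and>
    (\<exists>\<eta>. generates (fold (\<lambda>i. relax_coord (l i) (u i) i) is Z) (\<xi> @\<^sub>v \<eta>)
       (vec n (\<lambda>j. if j \<in> set is then max 0 (y $ j) else y $ j)))"
  using assms
proof (induction "is" arbitrary: Z \<xi> y)
  case Nil
  have "\<xi> @\<^sub>v vNil = \<xi>" by (intro eq_vecI) auto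
  moreover have "vec n (\<lambda>j. y $ j) = y" using generates_carrier[OF Nil(3,4)] by auto
  ultimately show ?case using Nil by (auto intro!: exI[of _ vNil])
next
  case (Cons i "is")
  let ?Z = "relax_coord (l i) (u i) i Z"
  let ?y = "relu_at i y"
  have y: "y \<in> carrier_vec n" using generates_carrier Cons.prems(3,4) .
  obtain \<eta> where wf: "well_formed n ?Z" and gen: "generates ?Z (\<xi> @\<^sub>v \<eta>) ?y"
    using relax_coord_generates[OF Cons.prems(3,4), of i "l i" "u i"] Cons.prems(2)[of i] by auto
  have same: "?y $ j = y $ j" if "j \<in> set is" for j
    using that Cons.prems(1,2) y by (auto simp: relu_at_def)
  have "\<And>j. j \<in> set is \<Longrightarrow> j < n \<and> l j < 0 \<and> l j \<le> ?y $ j \<and> ?y $ j \<le> u j"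
    using Cons.prems(2) same by auto
  from Cons.IH[OF _ this wf gen] Cons.prems(1) obtain \<zeta> where
    wf': "well_formed n (fold (\<lambda>i. relax_coord (l i) (u i) i) is ?Z)" and
    gen': "generates (fold (\<lambda>i. relax_coord (l i) (u i) i) is ?Z) ((\<xi> @\<^sub>v \<eta>) @\<^sub>v \<zeta>)
       (vec n (\<lambda>j. if j \<in> set is then max 0 (?y $ j) else ?y $ j))"
    by auto
  have "vec n (\<lambda>j. if j \<in> set is then max 0 (?y $ j) else ?y $ j)
    = vec n (\<lambda>j. if j \<in> set (i # is) then max 0 (y $ j) else y $ j)"
    using y by (intro eq_vecI) (auto simp: relu_at_def)
  then show ?case using wf' gen' by (auto simp: append_vec_assoc)
qed

text \<open>
  The coordinates that are skipped have a nonnegative lower bound, so the ReLU function does not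
  change them. The algorithm's test for emptiness fails because \<open>y\<close> belongs to the set.
\<close>
lemma relax_relu_generates:
  assumes wf: "well_formed n Z" and gen: "generates Z \<xi> y"
  shows "well_formed n (relax_relu Z) \<and> (\<exists>\<eta>. generates (relax_relu Z) (\<xi> @\<^sub>v \<eta>) (relu y))"
proof -
  let ?l = "coord_min (CZ Z)" and ?u = "coord_max (CZ Z)"
  let ?is = "filter (\<lambda>i. ?l i < 0) [0..<n]"
  have yZ: "y \<in> CZ Z" using gen by (auto simp: CZ_conv_generates)
  have y: "y \<in> carrier_vec n" using generates_carrier[OF wf gen] .
  have bounds: "?l i \<le> y $ i" "y $ i \<le> ?u i" if "i < n" for i
    using coord_bounds[OF wf that yZ] .
  have "dim_vec (fst Z) = n" using wf by (cases Z) auto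
  then have R: "relax_relu Z = fold (\<lambda>i. relax_coord (?l i) (?u i) i) ?is Z"
    using yZ by (auto simp: relax_relu_def Let_def)
  have relu: "vec n (\<lambda>j. if j \<in> set ?is then max 0 (y $ j) else y $ j) = relu y"
  proof (rule eq_vecI)
    fix j assume "j < dim_vec (relu y)"
    then have "j < n" using y by (simp add: relu_def)
    then show "vec n (\<lambda>j. if j \<in> set ?is then max 0 (y $ j) else y $ j) $ j = relu y $ j"
      using y bounds(1)[of j] by (auto simp: relu_def)
  qed (use y in \<open>simp add: relu_def\<close>)
  have "well_formed n (fold (\<lambda>i. relax_coord (?l i) (?u i) i) ?is Z) \<and>
    (\<exists>\<eta>. generates (fold (\<lambda>i. relax_coord (?l i) (?u i) i) ?is Z) (\<xi> @\<^sub>v \<eta>)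
       (vec n (\<lambda>j. if j \<in> set ?is then max 0 (y $ j) else y $ j)))"
    by (rule fold_relax_coord_generates[OF _ _ wf gen]) (use bounds in auto)
  then show ?thesis unfolding R relu .
qed

lemma affine_image_generates:
  assumes wf: "well_formed n Z" and gen: "generates Z \<xi> y"
    and W: "W \<in> carrier_mat p n" and v: "v \<in> carrier_vec p"
  shows "well_formed p (affine_image W v Z)"
    and "generates (affine_image W v Z) \<xi> (W *\<^sub>v y + v)"
proof -
  obtain c G A b where Z: "Z = (c, G, A, b)" by (cases Z)
  define N where "N = dim_col G"
  have c: "c \<in> carrier_vec n" and G: "G \<in> carrier_mat n N" and A: "A \<in> carrier_mat (dim_vec b) N"
    using wf by (auto simp: Z N_def)
  have \<xi>: "\<xi> \<in> carrier_vec N" "linf_norm \<xi> \<le> 1" "A *\<^sub>v \<xi> = b" and y: "y = G *\<^sub>v \<xi> + c"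
    using gen by (auto simp: Z N_def)
  show "well_formed p (affine_image W v Z)" using W v c G A by (auto simp: Z)
  have "W *\<^sub>v y + v = (W * G) *\<^sub>v \<xi> + (W *\<^sub>v c + v)"
    unfolding y using W v c G \<xi>(1)
    by (simp add: mult_add_distrib_mat_vec[of _ p n] assoc_add_vec[of _ p])
  then show "generates (affine_image W v Z) \<xi> (W *\<^sub>v y + v)"
    using \<xi> G by (simp add: Z)
qed

lemma hidden_approx_generates:
  assumes wf: "well_formed (d 0) Z" and gen: "generates Z \<xi> x"
    and W: "\<And>j. j < k \<Longrightarrow> W j \<in> carrier_mat (d (Suc j)) (d j)"
    and v: "\<And>j. j < k \<Longrightarrow> v j \<in> carrier_vec (d (Suc j))"
  shows "well_formed (d k) (hidden_approx W v Z k) \<and>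
    (\<exists>\<eta>. generates (hidden_approx W v Z k) (\<xi> @\<^sub>v \<eta>) (hidden W v x k))"
  using W v
proof (induction k)
  case 0
  have "\<xi> @\<^sub>v vNil = \<xi>" by (intro eq_vecI) auto
  then show ?case using wf gen by (auto intro!: exI[of _ vNil])
next
  case (Suc k)
  then obtain \<eta> where wf': "well_formed (d k) (hidden_approx W v Z k)"
    and gen': "generates (hidden_approx W v Z k) (\<xi> @\<^sub>v \<eta>) (hidden W v x k)"
    by (auto simp: less_Suc_eq)
  note affine_image_generates[OF wf' gen', of "W k" "d (Suc k)" "v k"]
  then show ?case
    using Suc.prems relax_relu_generates[of "d (Suc k)" "affine_image (W k) (v k) (hidden_approx W v Z k)"]
    by (fastforce simp: append_vec_assoc)
qed

lemma output_approx_generates: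
  assumes wf: "well_formed (d 0) Z" and gen: "generates Z \<xi> x" and L: "L \<ge> 1"
    and W: "\<And>j. j < L \<Longrightarrow> W j \<in> carrier_mat (d (Suc j)) (d j)"
    and v: "\<And>j. j < L \<Longrightarrow> v j \<in> carrier_vec (d (Suc j))"
  shows "well_formed (d L) (output_approx W v L Z) \<and>
    (\<exists>\<eta>. generates (output_approx W v L Z) (\<xi> @\<^sub>v \<eta>) (network W v L x))"
proof -
  have Suc: "Suc (L - 1) = L" using L by simp
  obtain \<eta> where "well_formed (d (L - 1)) (hidden_approx W v Z (L - 1))"
    and "generates (hidden_approx W v Z (L - 1)) (\<xi> @\<^sub>v \<eta>) (hidden W v x (L - 1))"
    using hidden_approx_generates[of d Z \<xi> x "L - 1" W v] assms by auto
  from affine_image_generates[OF this, of "W (L - 1)" "d L" "v (L - 1)"]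
  show ?thesis using W[of "L - 1"] v[of "L - 1"] L Suc
    by (auto simp: output_approx_def network_def)
qed

section \<open>The closed loop\<close>

theorem theorem2:
  fixes A\<^sub>d B\<^sub>d G A Ghat Ahat :: "real mat"
    and c b chat bhat :: "real vec"
    and W :: "nat \<Rightarrow> real mat" and v :: "nat \<Rightarrow> real vec" and d :: "nat \<Rightarrow> nat"
    and n m L nG nA :: nat
  assumes "A\<^sub>d \<in> carrier_mat n n" and "B\<^sub>d \<in> carrier_mat n m"
    and "L \<ge> 1" and "d 0 = n" and "d L = m"
    and "\<And>k. k < L \<Longrightarrow> W k \<in> carrier_mat (d (Suc k)) (d k)"
    and "\<And>k. k < L \<Longrightarrow> v k \<in> carrier_vec (d (Suc k))"
    and "c \<in> carrier_vec n" and "G \<in> carrier_mat n nG"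
    and "A \<in> carrier_mat nA nG" and "b \<in> carrier_vec nA"
    and "output_approx W v L (c, G, A, b) = (chat, Ghat, Ahat, bhat)"
  shows "closed_loop A\<^sub>d B\<^sub>d (network W v L) ` CZ (c, G, A, b)
    \<subseteq> CZ (A\<^sub>d *\<^sub>v c + B\<^sub>d *\<^sub>v chat,
          A\<^sub>d * (G @\<^sub>c 0\<^sub>m n (dim_col Ghat - nG)) + B\<^sub>d * Ghat,
          Ahat,
          bhat)"
proof (rule image_subsetI)
  fix x assume "x \<in> CZ (c, G, A, b)"
  then obtain \<xi> where gen: "generates (c, G, A, b) \<xi> x" by (auto simp: CZ_conv_generates)
  then have \<xi>: "\<xi> \<in> carrier_vec nG" and x: "x = G *\<^sub>v \<xi> + c" using assms(9) by auto
  have wf: "well_formed (d 0) (c, G, A, b)" using assms(4,8-11) by auto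
  obtain \<eta> where wf': "well_formed m (chat, Ghat, Ahat, bhat)"
    and gen': "generates (chat, Ghat, Ahat, bhat) (\<xi> @\<^sub>v \<eta>) (network W v L x)"
    using output_approx_generates[OF wf gen assms(3,6,7)] unfolding assms(12) assms(5) by blast
  define q where "q = dim_col Ghat - nG"
  have "\<xi> @\<^sub>v \<eta> \<in> carrier_vec (dim_col Ghat)" using gen' unfolding generates.simps by blast
  then have "dim_vec \<xi> + dim_vec \<eta> = dim_col Ghat" by (auto dest: carrier_vecD)
  then have q: "dim_col Ghat = nG + q" and \<eta>: "\<eta> \<in> carrier_vec q"
    using carrier_vecD[OF \<xi>] by (auto simp: q_def intro!: carrier_vecI)
  have chat: "chat \<in> carrier_vec m" and Ghat: "Ghat \<in> carrier_mat m (nG + q)"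
    using wf' q by auto
  \<comment> \<open>Padded with zero columns, \<open>G\<close> acts on the coefficients of the network output.\<close>
  define H where "H = G @\<^sub>c 0\<^sub>m n q"
  have H: "H \<in> carrier_mat n (nG + q)"
    unfolding H_def using assms(9) by (intro append_cols_carrier) auto
  have "H *\<^sub>v (\<xi> @\<^sub>v \<eta>) = G *\<^sub>v \<xi> + 0\<^sub>m n q *\<^sub>v \<eta>"
    unfolding H_def using assms(9) \<xi> \<eta> by (intro append_cols_mult_append_vec) auto
  also have "\<dots> = G *\<^sub>v \<xi>" using assms(9) \<eta> by (intro eq_vecI) auto
  finally have H\<xi>: "H *\<^sub>v (\<xi> @\<^sub>v \<eta>) = G *\<^sub>v \<xi>" .
  have s: "\<xi> @\<^sub>v \<eta> \<in> carrier_vec (nG + q)" using \<xi> \<eta> by simp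
  have "(A\<^sub>d * H + B\<^sub>d * Ghat) *\<^sub>v (\<xi> @\<^sub>v \<eta>) + (A\<^sub>d *\<^sub>v c + B\<^sub>d *\<^sub>v chat)
    = (A\<^sub>d *\<^sub>v (G *\<^sub>v \<xi>) + B\<^sub>d *\<^sub>v (Ghat *\<^sub>v (\<xi> @\<^sub>v \<eta>))) + (A\<^sub>d *\<^sub>v c + B\<^sub>d *\<^sub>v chat)"
    using assms(1,2) H Ghat s H\<xi>
    by (simp add: add_mult_distrib_mat_vec[of _ n "nG + q"] assoc_mult_mat_vec[of _ n _ _ "nG + q"])
  also have "\<dots> = A\<^sub>d *\<^sub>v (G *\<^sub>v \<xi> + c) + B\<^sub>d *\<^sub>v (Ghat *\<^sub>v (\<xi> @\<^sub>v \<eta>) + chat)"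
  proof -
    have "A\<^sub>d *\<^sub>v (G *\<^sub>v \<xi> + c) = A\<^sub>d *\<^sub>v (G *\<^sub>v \<xi>) + A\<^sub>d *\<^sub>v c"
      using assms(1,8,9) \<xi> by (intro mult_add_distrib_mat_vec[of _ n n]) auto
    moreover have "B\<^sub>d *\<^sub>v (Ghat *\<^sub>v (\<xi> @\<^sub>v \<eta>) + chat)
      = B\<^sub>d *\<^sub>v (Ghat *\<^sub>v (\<xi> @\<^sub>v \<eta>)) + B\<^sub>d *\<^sub>v chat"
      using assms(2) chat Ghat s by (intro mult_add_distrib_mat_vec[of _ n m]) auto
    ultimately show ?thesis using assms(1,2) by (intro eq_vecI) auto
  qed
  also have "\<dots> = closed_loop A\<^sub>d B\<^sub>d (network W v L) x"
    using gen' by (simp add: closed_loop_def x)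
  finally have eq: "closed_loop A\<^sub>d B\<^sub>d (network W v L) x
    = (A\<^sub>d * H + B\<^sub>d * Ghat) *\<^sub>v (\<xi> @\<^sub>v \<eta>) + (A\<^sub>d *\<^sub>v c + B\<^sub>d *\<^sub>v chat)" ..
  have "generates (A\<^sub>d *\<^sub>v c + B\<^sub>d *\<^sub>v chat, A\<^sub>d * H + B\<^sub>d * Ghat, Ahat, bhat) (\<xi> @\<^sub>v \<eta>)
    (closed_loop A\<^sub>d B\<^sub>d (network W v L) x)"
    using gen' eq by simp
  then show "closed_loop A\<^sub>d B\<^sub>d (network W v L) x
    \<in> CZ (A\<^sub>d *\<^sub>v c + B\<^sub>d *\<^sub>v chat,
          A\<^sub>d * (G @\<^sub>c 0\<^sub>m n (dim_col Ghat - nG)) + B\<^sub>d * Ghat, Ahat, bhat)"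
    unfolding CZ_conv_generates H_def q_def by blast
qed

end
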